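(* Let $n\ge 1$ and $k$ be integers with $\lfloor n/2\rfloor \le k\le \lfloor (2n-2)/3\rfloor$. Then the diameter of $\Phi^n_k$ is $$\operatorname{diam}(\Phi^n_k)=(2n-3k-2)(2k-n+1).$$
   Context: A subword of a word is a block of consecutive letters. A binary word (over $\{0,1\}$) of length $n\ge 1$ is Padovan if it starts and ends with $0$, contains no subword $00$, and contains no subword $111$. For $n\ge1$ and $\lfloor n/2\rfloor\le k\le\lfloor(2n-2)/3\rfloor$, the weighted Padovan graph $\Phi^n_k$ is the simple graph whose vertices are all Padovan words of length $n$ with exactly $k$ letters $1$; two vertices are adjacent if one can be obtained from the other by replacing exactly one subword $01$ with $10$. *)

theory Defs
  imports
    "Graph_Theory.Graph_Theory"
    "HOL-Library.Sublist"
    "HOL-Library.Z2"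
begin

text \<open>Binary words are lists over the two-element type \<^typ>\<open>bit\<close>; only its constants 0 and 1 are
  used. \<^const>\<open>sublist\<close> is the relation ``block of consecutive letters of''.\<close>

definition padovan :: "bit list \<Rightarrow> bool" where
  "padovan w \<longleftrightarrow> w \<noteq> [] \<and> hd w = 0 \<and> last w = 0
     \<and> \<not> sublist [0, 0] w \<and> \<not> sublist [1, 1, 1] w"

definition padovan_words :: "nat \<Rightarrow> nat \<Rightarrow> bit list set" where
  "padovan_words n k = {w. padovan w \<and> length w = n \<and> count_list w 1 = k}"

definition swap_01_10 :: "bit list \<Rightarrow> bit list \<Rightarrow> bool" where
  "swap_01_10 u v \<longleftrightarrow> (\<exists>p s. u = p @ [0, 1] @ s \<and> v = p @ [1, 0] @ s)"

text \<open>A simple graph is represented, as usual in the library, by a symmetric digraph: every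
  undirected edge is a pair of opposite arcs.\<close>

definition weighted_padovan_graph ::
    "nat \<Rightarrow> nat \<Rightarrow> (bit list, bit list \<times> bit list) pre_digraph" where
  "weighted_padovan_graph n k = with_proj
     \<lparr> pverts = padovan_words n k,
       parcs = {(u, v). u \<in> padovan_words n k \<and> v \<in> padovan_words n k
                  \<and> (swap_01_10 u v \<or> swap_01_10 v u)} \<rparr>"

text \<open>The distance of two vertices is the least number of arcs of a walk between them, that is,
  the library's shortest path cost for unit weights (infinite if there is no walk).\<close>

definition (in wf_digraph) diameter :: ereal where
  "diameter = (SUP (u, v) \<in> verts G \<times> verts G. \<mu> (\<lambda>_. 1) u v)"

lemma finite_padovan_words: "finite (padovan_words n k)"
proof (rule finite_subset)
  show "padovan_words n k \<subseteq> {w. set w \<subseteq> {0, 1} \<and> length w = n}"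
    unfolding padovan_words_def using bit_not_zero_iff by blast
  show "finite {w. set w \<subseteq> {0, 1 :: bit} \<and> length w = n}"
    by (rule finite_lists_length_eq) simp
qed

lemma not_swap_01_10_refl: "\<not> swap_01_10 w w"
  by (auto simp: swap_01_10_def)

lemma graph_weighted_padovan_graph: "graph (weighted_padovan_graph n k)"
proof -
  let ?G = "weighted_padovan_graph n k"
  have "arcs ?G \<subseteq> padovan_words n k \<times> padovan_words n k"
    by (auto simp: weighted_padovan_graph_def)
  then have "finite (arcs ?G)"
    by (rule finite_subset) (simp add: finite_padovan_words)
  then show ?thesis
    by unfold_locales
       (auto simp: weighted_padovan_graph_def finite_padovan_words not_swap_01_10_refl
          arc_to_ends_def symmetric_def sym_def)
qed

end

theory Submission
  imports Defs
begin

text \<open>A Padovan word is a product of blocks 01 and 011 followed by a final 0, and replacing 01 by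
  10 between two Padovan words swaps two neighbouring distinct blocks. With x blocks 011 and y blocks
  01, any arrangement of the blocks is reached from any other in at most xy swaps, by moving
  a block of the required kind to the first place where the arrangements differ. Conversely, a swap changes
  the sum of the positions of the letters 1 by one, and this sum differs by exactly xy between the
  two sorted arrangements.\<close>

subsection \<open>Adjacent swaps in two-letter words\<close>

text \<open>\<open>True\<close> will stand for the block 011 and \<open>False\<close> for 01. Either
  order of the unequal pair is allowed, which makes the relation symmetric, like adjacency in the
  graph.\<close>

definition adjacent_swap :: "bool list \<Rightarrow> bool list \<Rightarrow> bool" where
  "adjacent_swap u v \<longleftrightarrow> (\<exists>p a s. u = p @ [a, \<not> a] @ s \<and> v = p @ [\<not> a, a] @ s)"

lemma adjacent_swap_Cons: "adjacent_swap u v \<Longrightarrow> adjacent_swap (b # u) (b # v)"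
  unfolding adjacent_swap_def by (metis append_Cons)

lemma adjacent_swap_sym: "adjacent_swap u v \<Longrightarrow> adjacent_swap v u"
  unfolding adjacent_swap_def
proof (elim exE conjE)
  fix p a s
  assume "u = p @ [a, \<not> a] @ s" "v = p @ [\<not> a, a] @ s"
  then show "\<exists>p a s. v = p @ [a, \<not> a] @ s \<and> u = p @ [\<not> a, a] @ s"
    by (intro exI[of _ p] exI[of _ "\<not> a"] exI[of _ s]) simp
qed

lemma relpowp_adjacent_swap_Cons:
  "(adjacent_swap ^^ d) u v \<Longrightarrow> (adjacent_swap ^^ d) (b # u) (b # v)"
  by (induction d arbitrary: v) (auto intro!: relcomppI adjacent_swap_Cons)

lemma relpowp_adjacent_swap_sym: "(adjacent_swap ^^ d) u v \<Longrightarrow> (adjacent_swap ^^ d) v u"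
proof (induction d arbitrary: v)
  case (Suc d)
  then obtain w where "(adjacent_swap ^^ d) u w" "adjacent_swap w v"
    by (auto elim: relcomppE)
  then show ?case
    using Suc.IH adjacent_swap_sym by (blast intro: relpowp_Suc_I2)
qed simp

text \<open>One swap per copy of \<open>c\<close> passed: by induction the other letter first gets
  past all copies but the leading one, then past that one.\<close>

lemma relpowp_adjacent_swap_replicate:
  "(adjacent_swap ^^ a) (replicate a c @ (\<not> c) # s) ((\<not> c) # replicate a c @ s)"
proof (induction a)
  case (Suc a)
  have "(adjacent_swap ^^ a) (replicate (Suc a) c @ (\<not> c) # s) (c # (\<not> c) # replicate a c @ s)"
    using relpowp_adjacent_swap_Cons[OF Suc] by simp
  moreover have "adjacent_swap (c # (\<not> c) # replicate a c @ s) ((\<not> c) # replicate (Suc a) c @ s)"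
    unfolding adjacent_swap_def by (rule exI[of _ "[]"]) auto
  ultimately show ?case
    by (rule relpowp_Suc_I)
qed simp

text \<open>Equal first letters are dropped. Otherwise the required letter, say
  \<open>False\<close>, is brought to the front past a letters \<open>True\<close> and then dropped.
  With x letters \<open>True\<close> and y letters \<open>False\<close> this costs at most a + x (y
  - 1), which is at most x y because a \<le> x.\<close>

lemma ex_relpowp_adjacent_swap:
  assumes "count_list u True = count_list v True" "count_list u False = count_list v False"
  shows "\<exists>d \<le> count_list u True * count_list u False. (adjacent_swap ^^ d) u v"
  using assms
proof (induction "length u" arbitrary: u v)
  case 0
  then have "v = []"
    by (cases v; cases "hd v") auto
  then show ?case
    using 0 by auto
next
  case (Suc m)
  \<comment> \<open>The words are bound anew, so that the opposite mismatch can be settled by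
    exchanging them.\<close>
  have *: "\<exists>d \<le> count_list u True * count_list u False. (adjacent_swap ^^ d) u v"
    if u: "u = True # u'" and v: "v = False # v'" and len: "Suc m = length u"
      and eq: "count_list u True = count_list v True" "count_list u False = count_list v False"
    for u v u' v'
  proof -
    have "False \<in> set u"
      using eq(2) v count_list_0_iff[of u False] by auto
    then obtain r s where rs: "u = r @ False # s" "False \<notin> set r"
      by (meson split_list_first)
    define a where "a = length r"
    have "r = replicate a True"
      unfolding a_def using rs(2) by (metis (full_types) replicate_length_same)
    then have ua: "u = replicate a True @ False # s"
      using rs by simp
    have cr: "count_list (replicate a True) True = a" "count_list (replicate a True) False = 0"
      by (induction a) auto
    obtain d where d: "d \<le> count_list (replicate a True @ s) True * count_list (replicate a True @ s) False"
        "(adjacent_swap ^^ d) (replicate a True @ s) v'"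
      using Suc.hyps(1)[of "replicate a True @ s" v'] eq len cr by (auto simp: ua v)
    have "(adjacent_swap ^^ (a + d)) u v"
      using relpowp_adjacent_swap_replicate[of a True s] relpowp_adjacent_swap_Cons[OF d(2), of False]
      unfolding ua v by (auto simp: relpowp_add)
    moreover have "a + d \<le> count_list u True * count_list u False"
      using d(1) cr by (simp add: ua)
    ultimately show ?thesis
      by blast
  qed
  obtain b u' where u: "u = b # u'"
    using Suc.hyps(2) by (cases u) auto
  have "v \<noteq> []"
    using Suc.prems u by (cases b) auto
  then obtain c v' where v: "v = c # v'"
    by (cases v) auto
  consider "b = c" | "b" "\<not> c" | "\<not> b" "c"
    by blast
  then show ?case
  proof cases
    case 1
    have "\<exists>d \<le> count_list u' True * count_list u' False. (adjacent_swap ^^ d) u' v'"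
      using Suc.prems Suc.hyps(2) 1 by (intro Suc.hyps(1)) (auto simp: u v split: if_splits)
    then obtain d where "d \<le> count_list u' True * count_list u' False" "(adjacent_swap ^^ d) u' v'"
      by blast
    moreover have "count_list u' True * count_list u' False \<le> count_list u True * count_list u False"
      by (simp add: u)
    ultimately show ?thesis
      using relpowp_adjacent_swap_Cons[of d u' v' b] 1 u v order_trans by blast
  next
    case 2
    then show ?thesis
      using *[of u u' v v'] Suc u v by simp
  next
    case 3
    \<comment> \<open>The exchanged use of \<open>*\<close> asks for the length of \<open>v\<close>;
      equal letter counts force equal lengths.\<close>
    have "length w = count_list w True + count_list w False" for w
      by (induction w) auto
    then have "length v = length u"
      using Suc.prems by simp
    then show ?thesis
      using *[of v v' u u'] Suc u v 3 relpowp_adjacent_swap_sym by fastforce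
  qed
qed

subsection \<open>The block decomposition of Padovan words\<close>

text \<open>The final 0 of a Padovan word is left out, so that appending block sequences appends
  words.\<close>

definition blocks :: "bool list \<Rightarrow> bit list" where
  "blocks bs = concat (map (\<lambda>b. if b then [0, 1, 1] else [0, 1]) bs)"

lemma blocks_simps [simp]:
  "blocks [] = []"
  "blocks (b # bs) = (if b then [0, 1, 1] else [0, 1]) @ blocks bs"
  "blocks (bs @ cs) = blocks bs @ blocks cs"
  by (simp_all add: blocks_def)

lemma length_blocks: "length (blocks bs) = 3 * count_list bs True + 2 * count_list bs False"
  by (induction bs) auto

lemma count_list_blocks: "count_list (blocks bs) 1 = 2 * count_list bs True + count_list bs False"
  by (induction bs) auto

lemma padovan_blocks: "padovan (blocks bs @ [0])"
proof (induction bs)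
  case Nil
  show ?case
    by (simp add: padovan_def sublist_Cons_right)
next
  case (Cons b bs)
  \<comment> \<open>What follows a block starts with 0, which ends its run of ones; as the block
    ends in 1, no 00 arises at the seam.\<close>
  obtain r where "blocks bs @ [0] = 0 # r"
    by (cases bs; cases "hd bs") auto
  then show ?case
    using Cons by (auto simp: padovan_def sublist_Cons_right)
qed

text \<open>Blocks are peeled off from the left: after the initial 0 come one or two ones and then
  another 0, where the argument restarts. The induction is on length because a block takes two or
  three letters.\<close>

lemma padovan_imp_blocks: "padovan w \<Longrightarrow> \<exists>bs. w = blocks bs @ [0]"
proof (induction w rule: length_induct)
  case (1 w)
  have tail: "\<exists>bs. 0 # r = blocks bs @ [0]" if "w = p @ 0 # r" "p \<noteq> []" for p r
  proof -
    have "padovan (0 # r)"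
      using 1(2) that by (auto simp: padovan_def sublist_append)
    then show ?thesis
      using 1(1) that by auto
  qed
  obtain r where r: "w = 0 # r"
    using 1(2) by (cases w) (auto simp: padovan_def)
  show ?case
  proof (cases r)
    case Nil
    then have "w = blocks [] @ [0]"
      by (simp add: r)
    then show ?thesis
      by blast
  next
    case (Cons x s)
    then have x: "x = 1"
      using 1(2) by (cases x) (auto simp: r padovan_def sublist_Cons_right)
    \<comment> \<open>The last letter is 0, so the word cannot stop after this 1.\<close>
    then obtain y t where y: "s = y # t"
      using 1(2) Cons by (cases s) (auto simp: r padovan_def)
    show ?thesis
    proof (cases y)
      case zero
      then obtain bs where "0 # t = blocks bs @ [0]"
        using tail[of "[0, 1]" t] by (auto simp: r Cons x y)
      then have "w = blocks (False # bs) @ [0]"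
        by (simp add: r Cons x y zero)
      then show ?thesis
        by blast
    next
      case one
      then obtain z t' where z: "t = z # t'"
        using 1(2) Cons x y by (cases t) (auto simp: r padovan_def)
      have "z = 0"
        using 1(2) by (cases z) (auto simp: r Cons x y one z padovan_def sublist_Cons_right)
      then obtain bs where "0 # t' = blocks bs @ [0]"
        using tail[of "[0, 1, 1]" t'] by (auto simp: r Cons x y one z)
      then have "w = blocks (True # bs) @ [0]"
        using \<open>z = 0\<close> by (simp add: r Cons x y one z)
      then show ?thesis
        by blast
    qed
  qed
qed

lemma blocks_in_padovan_words_iff:
  "blocks bs @ [0] \<in> padovan_words n k \<longleftrightarrow>
     3 * count_list bs True + 2 * count_list bs False + 1 = n \<and>
     2 * count_list bs True + count_list bs False = k"
  by (simp add: padovan_words_def padovan_blocks length_blocks count_list_blocks)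

lemma adjacent_swap_imp_swap_01_10:
  assumes "adjacent_swap bs cs"
  shows "swap_01_10 (blocks bs @ [0]) (blocks cs @ [0]) \<or> swap_01_10 (blocks cs @ [0]) (blocks bs @ [0])"
proof -
  \<comment> \<open>The word 01 011 reads 01 01 1; replacing its second 01 gives 01 10 1, which is
    011 01.\<close>
  have *: "swap_01_10 (blocks (p @ [False, True] @ s) @ [0]) (blocks (p @ [True, False] @ s) @ [0])" for p s
    unfolding swap_01_10_def
    by (intro exI[of _ "blocks p @ [0, 1]"] exI[of _ "1 # blocks s @ [0]"]) simp
  obtain p a s where "bs = p @ [a, \<not> a] @ s" "cs = p @ [\<not> a, a] @ s"
    using assms unfolding adjacent_swap_def by blast
  then show ?thesis
    using *[of p s] by (cases a) simp_all
qed

lemma adjacent_swap_count_list: "adjacent_swap bs cs \<Longrightarrow> count_list bs b = count_list cs b"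
  by (auto simp: adjacent_swap_def)

subsection \<open>The sum of the positions of the letters 1\<close>

text \<open>Positions count from 0: a letter put in front adds nothing itself but shifts every later
  1 by one place.\<close>

primrec position_sum :: "bit list \<Rightarrow> nat" where
  "position_sum [] = 0"
| "position_sum (b # w) = position_sum w + count_list w 1"

lemma position_sum_append:
  "position_sum (u @ v) = position_sum u + position_sum v + length u * count_list v 1"
  by (induction u) auto

lemma position_sum_swap: "swap_01_10 u v \<Longrightarrow> position_sum u = position_sum v + 1"
  by (auto simp: swap_01_10_def position_sum_append)

subsection \<open>Distances in the weighted Padovan graph\<close>

lemma wf_digraph_weighted_padovan_graph: "wf_digraph (weighted_padovan_graph n k)"
proof -
  interpret graph "weighted_padovan_graph n k"
    by (rule graph_weighted_padovan_graph)
  show ?thesis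
    by unfold_locales
qed

lemma verts_weighted_padovan_graph [simp]: "verts (weighted_padovan_graph n k) = padovan_words n k"
  by (simp add: weighted_padovan_graph_def)

lemma in_arcs_weighted_padovan_graph_iff:
  "(u, v) \<in> arcs (weighted_padovan_graph n k) \<longleftrightarrow>
     u \<in> padovan_words n k \<and> v \<in> padovan_words n k \<and> (swap_01_10 u v \<or> swap_01_10 v u)"
  by (simp add: weighted_padovan_graph_def)

lemma tail_head_weighted_padovan_graph [simp]:
  "tail (weighted_padovan_graph n k) e = fst e" "head (weighted_padovan_graph n k) e = snd e"
  by (simp_all add: weighted_padovan_graph_def)

lemma (in wf_digraph) awalk_cost_unit: "awalk_cost (\<lambda>_. 1) p = real (length p)"
  by (induction p) auto

text \<open>Swaps keep the block counts, so every intermediate word is a vertex of the same graph.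
  The first swap is split off because walks grow at their front.\<close>

lemma relpowp_adjacent_swap_imp_awalk:
  assumes "(adjacent_swap ^^ d) bs cs" "blocks bs @ [0] \<in> padovan_words n k"
  shows "\<exists>p. pre_digraph.awalk (weighted_padovan_graph n k) (blocks bs @ [0]) p (blocks cs @ [0])
    \<and> length p = d"
proof -
  interpret wf_digraph "weighted_padovan_graph n k"
    by (rule wf_digraph_weighted_padovan_graph)
  show ?thesis
    using assms
  proof (induction d arbitrary: bs)
    case 0
    then show ?case
      by (auto simp: awalk_Nil_iff)
  next
    case (Suc d)
    then obtain ds where ds: "adjacent_swap bs ds" "(adjacent_swap ^^ d) ds cs"
      by (meson relpowp_Suc_D2)
    have "blocks ds @ [0] \<in> padovan_words n k"
      using Suc.prems(2) adjacent_swap_count_list[OF ds(1)] by (simp add: blocks_in_padovan_words_iff)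
    moreover from this obtain p where "awalk (blocks ds @ [0]) p (blocks cs @ [0])" "length p = d"
      using Suc.IH[OF ds(2)] by blast
    ultimately have "awalk (blocks bs @ [0]) ((blocks bs @ [0], blocks ds @ [0]) # p) (blocks cs @ [0])"
      using Suc.prems(2) adjacent_swap_imp_swap_01_10[OF ds(1)]
      by (simp add: awalk_Cons_iff in_arcs_weighted_padovan_graph_iff)
    then show ?case
      using \<open>length p = d\<close> by (metis length_Cons)
  qed
qed

text \<open>An arc is a swap read in one of two directions, so it changes the sum by one; a gap
  between two sums thus bounds every walk length from below.\<close>

lemma position_sum_le_awalk:
  assumes "pre_digraph.awalk (weighted_padovan_graph n k) u p v"
  shows "position_sum v \<le> position_sum u + length p"
proof -
  interpret wf_digraph "weighted_padovan_graph n k"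
    by (rule wf_digraph_weighted_padovan_graph)
  show ?thesis
    using assms
  proof (induction p arbitrary: u)
    case Nil
    then show ?case
      by (simp add: awalk_Nil_iff)
  next
    case (Cons e p)
    obtain w where e: "e = (u, w)"
      using Cons.prems by (cases e) (simp add: awalk_Cons_iff)
    then have "position_sum v \<le> position_sum w + length p"
      and "(u, w) \<in> arcs (weighted_padovan_graph n k)"
      using Cons.prems Cons.IH[of w] by (auto simp: awalk_Cons_iff)
    then show ?case
      using position_sum_swap[of u w] position_sum_swap[of w u]
      by (auto simp: in_arcs_weighted_padovan_graph_iff)
  qed
qed

text \<open>Using the block numbers x and y as parameters keeps truncated subtraction out of the
  argument.\<close>

lemma diameter_weighted_padovan_graph:
  fixes x y :: nat
  assumes n: "n = 3 * x + 2 * y + 1" and k: "k = 2 * x + y"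
  shows "wf_digraph.diameter (weighted_padovan_graph n k) = ereal (real (x * y))"
proof -
  interpret wf_digraph "weighted_padovan_graph n k"
    by (rule wf_digraph_weighted_padovan_graph)
  \<comment> \<open>Length and weight give two independent linear equations, so they determine both
    block numbers.\<close>
  have in_words: "blocks bs @ [0] \<in> padovan_words n k \<longleftrightarrow>
      count_list bs True = x \<and> count_list bs False = y" for bs
    by (auto simp: blocks_in_padovan_words_iff n k)
  have upper: "\<mu> (\<lambda>_. 1) u v \<le> ereal (real (x * y))"
    if uv: "u \<in> padovan_words n k" "v \<in> padovan_words n k" for u v
  proof -
    obtain bs cs where bc: "u = blocks bs @ [0]" "v = blocks cs @ [0]"
      using uv padovan_imp_blocks unfolding padovan_words_def by blast
    obtain d where d: "d \<le> x * y" "(adjacent_swap ^^ d) bs cs"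
      using ex_relpowp_adjacent_swap[of bs cs] uv by (auto simp: bc in_words)
    obtain p where p: "awalk u p v" "length p = d"
      using relpowp_adjacent_swap_imp_awalk[OF d(2)] uv(1) bc by auto
    have "\<mu> (\<lambda>_. 1) u v \<le> ereal (awalk_cost (\<lambda>_. 1) p)"
      using p(1) unfolding \<mu>_def by (intro INF_lower) simp
    also have "\<dots> \<le> ereal (real (x * y))"
      using d(1) p(2) by (simp only: awalk_cost_unit ereal_less_eq of_nat_le_iff)
    finally show ?thesis .
  qed
  define u where "u = blocks (replicate x True @ replicate y False) @ [0]"
  define v where "v = blocks (replicate y False @ replicate x True) @ [0]"
  have cr: "count_list (replicate a b) c = (if b = c then a else 0)" for a and b c :: bool
    by (induction a) auto
  have uv: "u \<in> padovan_words n k" "v \<in> padovan_words n k"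
    unfolding u_def v_def in_words by (simp_all add: cr)
  \<comment> \<open>Both words consist of the same two runs, so only the offset of the second run
    matters: 2y letters before 2x ones in \<open>v\<close>, 3x letters before y ones in
    \<open>u\<close>, and 4xy - 3xy = xy.\<close>
  have "position_sum v = position_sum u + x * y"
    by (simp add: u_def v_def position_sum_append length_blocks count_list_blocks cr)
  then have lower: "ereal (real (x * y)) \<le> \<mu> (\<lambda>_. 1) u v"
    unfolding \<mu>_def
    by (intro INF_greatest) (use position_sum_le_awalk in \<open>fastforce simp: awalk_cost_unit
      simp flip: of_nat_mult\<close>)
  show ?thesis
  proof (rule antisym)
    show "diameter \<le> ereal (real (x * y))"
      unfolding diameter_def using upper by (intro SUP_least) auto
    show "ereal (real (x * y)) \<le> diameter"
      unfolding diameter_def using uv lower by (intro SUP_upper2[of "(u, v)"]) auto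
  qed
qed

theorem proposition4p3:
  fixes n k :: nat
  assumes "n \<ge> 1"
    and "n div 2 \<le> k"
    and "k \<le> (2 * n - 2) div 3"
  shows "wf_digraph.diameter (weighted_padovan_graph n k)
    = ereal (real_of_int ((2 * int n - 3 * int k - 2) * (2 * int k - int n + 1)))"
proof -
  \<comment> \<open>These solve n = 3x + 2y + 1 and k = 2x + y. The bounds on k give n \<le> 2k + 1
    and 3k \<le> 2n - 2, so no subtraction is truncated.\<close>
  define x y where "x = 2 * k + 1 - n" and "y = 2 * n - 2 - 3 * k"
  have "n = 3 * x + 2 * y + 1" "k = 2 * x + y"
    using assms by (auto simp: x_def y_def)
  moreover have "int x = 2 * int k - int n + 1" "int y = 2 * int n - 3 * int k - 2"
    using assms by (auto simp: x_def y_def)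
  ultimately show ?thesis
    using diameter_weighted_padovan_graph[of n x y k]
    by (metis mult.commute of_int_of_nat_eq of_nat_mult)
qed

end
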